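(* Let $q$ be a prime power and let $\gamma\in\mathbb{F}_q^*$. Let $W^0_\gamma=\{(x,x^q+\gamma h): x\in\mathbb{F}_{q^5},\ \mathrm{Tr}_{q^5/q}(x)=0,\ h\in\mathbb{F}_q\}$, $W^1_\gamma=\{(x,x^q+\gamma\,\mathrm{Tr}_{q^5/q}(x)): x\in\mathbb{F}_{q^5}\}$, and $L^\varepsilon_\gamma=L_{W^\varepsilon_\gamma}\subseteq\mathrm{PG}(1,q^5)$ for $\varepsilon\in\{0,1\}$. Then $L^\varepsilon_\gamma$ is of LP type whenever one of the following conditions holds: (a) $\varepsilon=0$ and $\operatorname{char}(\mathbb{F}_q)=7$; (b) $\varepsilon=1$ and $7\gamma^2+5\gamma+1=0$.
   Context: For an $\mathbb{F}_q$-subspace $U$ of $\mathbb{F}_{q^5}^2$, $L_U=\{\langle \mathbf{u}\rangle_{\mathbb{F}_{q^5}}:\mathbf{u}\in U\setminus\{\mathbf 0\}\}\subseteq\mathrm{PG}(1,q^5)$. $\mathrm{Tr}_{q^5/q}(x)=x+x^q+x^{q^2}+x^{q^3}+x^{q^4}$ and $\mathrm{N}_{q^5/q}(x)=x^{1+q+q^2+q^3+q^4}$. Two linear sets are projectively equivalent if an element of $\mathrm{PGL}(2,q^5)$ maps one onto the other as point sets. A linear set of $\mathrm{PG}(1,q^5)$ is of LP (Lunardon--Polverino) type if it is projectively equivalent to $\{\langle(x,x^{q^s}+\delta x^{q^{5-s}})\rangle_{\mathbb{F}_{q^5}}:x\in\mathbb{F}_{q^5}^*\}$ for some $1\le s<5$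 and some $\delta\in\mathbb{F}_{q^5}$ with $\mathrm{N}_{q^5/q}(\delta)\notin\{0,1\}$. *)

theory Defs
  imports "HOL-Analysis.Analysis" "HOL-Number_Theory.Prime_Powers"
    "HOL-Computational_Algebra.Polynomial"
begin

text \<open>
  The field with \<open>q\<^sup>5\<close> elements is a finite field type \<open>'a\<close> with \<open>CARD('a) = q ^ 5\<close>, and
  \<open>PG(1, q\<^sup>5)\<close> is the set of one-dimensional \<open>'a\<close>-subspaces of \<open>'a ^ 2\<close>. The subfield with
  \<open>q\<close> elements is the set of fixed points of \<open>x \<mapsto> x ^ q\<close>; the lemmas below confirm that this
  set is a subfield of cardinality \<open>q\<close>.
\<close>

definition Fq :: "nat \<Rightarrow> ('a :: finite_field) set" where
  "Fq q = {x. x ^ q = x}"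

definition Tr5 :: "nat \<Rightarrow> 'a :: finite_field \<Rightarrow> 'a" where
  "Tr5 q x = x + x ^ q + x ^ (q ^ 2) + x ^ (q ^ 3) + x ^ (q ^ 4)"

definition Nm5 :: "nat \<Rightarrow> 'a :: finite_field \<Rightarrow> 'a" where
  "Nm5 q x = x ^ (1 + q + q ^ 2 + q ^ 3 + q ^ 4)"

definition point :: "('a :: finite_field) ^ 2 \<Rightarrow> ('a ^ 2) set" where
  "point u = vec.span {u}"

definition linear_set :: "(('a :: finite_field) ^ 2) set \<Rightarrow> ('a ^ 2) set set" where
  "linear_set U = {point u | u. u \<in> U \<and> u \<noteq> 0}"

definition proj_equiv ::
  "(('a :: finite_field) ^ 2) set set \<Rightarrow> ('a ^ 2) set set \<Rightarrow> bool" where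
  "proj_equiv L M \<longleftrightarrow> (\<exists>A :: 'a ^ 2 ^ 2. invertible A \<and> (\<lambda>P. (\<lambda>v. A *v v) ` P) ` L = M)"

definition LP_type :: "nat \<Rightarrow> (('a :: finite_field) ^ 2) set set \<Rightarrow> bool" where
  "LP_type q L \<longleftrightarrow>
     (\<exists>s \<delta>. 1 \<le> s \<and> s < 5 \<and> Nm5 q \<delta> \<notin> {0, 1} \<and>
        proj_equiv L {point (vector [x, x ^ (q ^ s) + \<delta> * x ^ (q ^ (5 - s))]) | x. x \<noteq> 0})"

definition W0 :: "nat \<Rightarrow> 'a :: finite_field \<Rightarrow> ('a ^ 2) set" where
  "W0 q \<gamma> = {vector [x, x ^ q + \<gamma> * h] | x h. Tr5 q x = 0 \<and> h \<in> Fq q}"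

definition W1 :: "nat \<Rightarrow> 'a :: finite_field \<Rightarrow> ('a ^ 2) set" where
  "W1 q \<gamma> = {vector [x, x ^ q + \<gamma> * Tr5 q x] | x. True}"

lemma q_power_of_CHAR:
  assumes "primepow q" and "CARD('a :: finite_field) = q ^ 5"
  obtains k where "k > 0" "q = CHAR('a) ^ k" "prime CHAR('a)"
proof -
  obtain p k where pk: "prime p" "k > 0" "q = p ^ k"
    using assms(1) by (auto simp: primepow_def)
  have pr: "prime CHAR('a)"
    by (rule prime_CHAR_semidom) simp
  have "CHAR('a) dvd q ^ 5"
  proof -
    have "(\<Sum>x\<in>(UNIV :: 'a set). x) = (\<Sum>x\<in>UNIV. x + 1)"
      by (rule sum.reindex_bij_witness[of _ "\<lambda>x. x + 1" "\<lambda>x. x - 1"]) auto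
    hence "of_nat CARD('a) = (0 :: 'a)" by (simp add: sum.distrib)
    thus ?thesis using assms(2) by (simp only: of_nat_eq_0_iff_char_dvd)
  qed
  hence "CHAR('a) dvd p"
    using pr pk by (metis prime_dvd_power)
  hence "CHAR('a) = p"
    using pr pk by (simp add: primes_dvd_imp_eq)
  thus ?thesis using that pk by blast
qed

lemma power_q_add:
  fixes x y :: "'a :: finite_field"
  assumes "primepow q" and "CARD('a) = q ^ 5"
  shows "(x + y) ^ q = x ^ q + y ^ q"
  using q_power_of_CHAR[OF assms] freshmans_dream' by metis

lemma Fq_subfield:
  assumes "primepow q" and "CARD('a :: finite_field) = q ^ 5"
  shows "0 \<in> (Fq q :: 'a set)" "1 \<in> (Fq q :: 'a set)"
    and "x \<in> Fq q \<Longrightarrow> y \<in> Fq q \<Longrightarrow> x + y \<in> (Fq q :: 'a set)"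
    and "x \<in> Fq q \<Longrightarrow> - x \<in> (Fq q :: 'a set)"
    and "x \<in> Fq q \<Longrightarrow> y \<in> Fq q \<Longrightarrow> x * y \<in> (Fq q :: 'a set)"
    and "x \<in> Fq q \<Longrightarrow> inverse x \<in> (Fq q :: 'a set)"
proof -
  have q: "q > 0" using assms(1) primepow_gt_0_nat by blast
  show "0 \<in> (Fq q :: 'a set)" "1 \<in> (Fq q :: 'a set)" using q by (auto simp: Fq_def)
  show "x + y \<in> (Fq q :: 'a set)" if "x \<in> Fq q" "y \<in> Fq q"
    using that power_q_add[OF assms] by (simp add: Fq_def)
  show "x * y \<in> (Fq q :: 'a set)" if "x \<in> Fq q" "y \<in> Fq q"
    using that by (simp add: Fq_def power_mult_distrib)
  show "inverse x \<in> (Fq q :: 'a set)" if "x \<in> Fq q"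
    using that by (simp add: Fq_def power_inverse)
  show "- x \<in> (Fq q :: 'a set)" if "x \<in> Fq q"
  proof -
    have "x ^ q + (- x) ^ q = 0"
      using power_q_add[OF assms, of x "- x"] q by (simp add: zero_power)
    thus ?thesis using that by (simp add: Fq_def add_eq_0_iff)
  qed
qed

lemma card_Fq:
  assumes "primepow q" and "CARD('a :: finite_field) = q ^ 5"
  shows "card (Fq q :: 'a set) = q"
proof -
  have q: "q > 1" using assms(1) primepow_gt_Suc_0 by fastforce
  define f :: "'a \<Rightarrow> 'a" where "f = (\<lambda>x. x ^ q - x)"
  have diff: "(x - y) ^ q = x ^ q - y ^ q" for x y :: 'a
    using power_q_add[OF assms, of "x - y" y] by (simp add: algebra_simps)
  have "card {x :: 'a. poly (monom 1 q - monom 1 1) x = 0} \<le> degree (monom (1 :: 'a) q - monom 1 1)"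
  proof (rule card_poly_roots_bound)
    have "coeff (monom (1 :: 'a) q - monom 1 1) q = 1" using q by simp
    thus "monom (1 :: 'a) q - monom 1 1 \<noteq> 0" by (metis coeff_0 zero_neq_one)
  qed
  also have "\<dots> \<le> q" using q by (intro degree_diff_le degree_monom_le[THEN order_trans]) auto
  finally have upper: "card (Fq q :: 'a set) \<le> q"
    by (simp add: Fq_def poly_monom)
  define t :: "'a poly" where
    "t = monom 1 1 + monom 1 q + monom 1 (q ^ 2) + monom 1 (q ^ 3) + monom 1 (q ^ 4)"
  have lt: "1 < q ^ 4" "q < q ^ 4" "q ^ 2 < q ^ 4" "q ^ 3 < q ^ 4"
    using q power_strict_increasing[of 1 4 q] power_strict_increasing[of 2 4 q]
      power_strict_increasing[of 3 4 q] by auto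
  have t: "poly t x = Tr5 q x" for x
    by (simp add: t_def Tr5_def poly_monom)
  have "card {x. poly t x = 0} \<le> degree t"
  proof (rule card_poly_roots_bound)
    have "coeff t (q ^ 4) = 1" using lt by (auto simp: t_def)
    thus "t \<noteq> 0" by (metis coeff_0 zero_neq_one)
  qed
  also have "degree t \<le> q ^ 4" unfolding t_def
    using lt by (intro degree_add_le degree_monom_le[THEN order_trans]) auto
  finally have trbound: "card {x :: 'a. Tr5 q x = 0} \<le> q ^ 4" by (simp add: t)
  have tr0: "Tr5 q (f x) = 0" for x
  proof -
    have iter: "(f x) ^ (q ^ i) = x ^ (q ^ Suc i) - x ^ (q ^ i)" for i
    proof (induction i)
      case (Suc i)
      have "(f x) ^ (q ^ Suc i) = ((f x) ^ (q ^ i)) ^ q" by (simp add: power_mult[symmetric] mult.commute)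
      also have "\<dots> = (x ^ (q ^ Suc i) - x ^ (q ^ i)) ^ q" by (simp only: Suc.IH)
      also have "\<dots> = x ^ (q ^ Suc (Suc i)) - x ^ (q ^ Suc i)"
        by (simp add: diff power_mult[symmetric] mult_ac)
      finally show ?case .
    qed (simp add: f_def)
    have "x ^ (q ^ 5) = x"
      using finite_field_power_card_eq_same[of x] assms(2) by simp
    thus ?thesis
      using iter[of 0] iter[of 1] iter[of 2] iter[of 3] iter[of 4]
      by (simp add: Tr5_def eval_nat_numeral)
  qed
  have fib: "card {x. f x = y} = card (Fq q :: 'a set)" if y: "y \<in> range f" for y
  proof -
    obtain x0 where x0: "y = f x0" using y by auto
    have "bij_betw (\<lambda>z. z + x0) (Fq q) {x. f x = y}"
    proof (rule bij_betwI[where g = "\<lambda>x. x - x0"])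
      show "(\<lambda>z. z + x0) \<in> Fq q \<rightarrow> {x. f x = y}"
        using power_q_add[OF assms] by (auto simp: Fq_def f_def x0)
      show "(\<lambda>x. x - x0) \<in> {x. f x = y} \<rightarrow> Fq q"
        by (auto simp: Fq_def f_def x0 diff algebra_simps)
    qed auto
    thus ?thesis by (simp add: bij_betw_same_card)
  qed
  have "q ^ 5 = card (\<Union>y \<in> range f. {x. f x = y})"
  proof -
    have "(\<Union>y \<in> range f. {x. f x = y}) = UNIV" by auto
    thus ?thesis using assms(2) by simp
  qed
  also have "\<dots> = (\<Sum>y \<in> range f. card {x. f x = y})"
    by (rule card_UN_disjoint) auto
  also have "\<dots> = card (range f) * card (Fq q :: 'a set)" by (simp add: fib)
  also have "\<dots> \<le> q ^ 4 * card (Fq q :: 'a set)"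
  proof (rule mult_right_mono)
    have "card (range f) \<le> card {x :: 'a. Tr5 q x = 0}" by (rule card_mono) (auto simp: tr0)
    thus "card (range f) \<le> q ^ 4" using trbound by simp
  qed simp
  finally have "q ^ 4 * q \<le> q ^ 4 * card (Fq q :: 'a set)"
    by (simp add: eval_nat_numeral mult_ac)
  hence "q \<le> card (Fq q :: 'a set)" using q by simp
  with upper show ?thesis by simp
qed

end

theory Submission
  imports Defs
begin

text \<open>
  Both cases are instances of one family: for \<open>\<delta> \<in> \<bbbF>\<^sub>q\<close> with \<open>\<delta>\<^sup>2 - \<delta> + 1 = 0\<close>, the matrix with
  rows \<open>(-1, \<delta> - 1)\<close> and \<open>(1, 1)\<close> maps \<open>{(x, x^q + t) | t \<in> \<bbbF>\<^sub>q, Tr x = (\<delta> - 3) t}\<close> onto the graph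
  of \<open>u \<mapsto> u^(q^2) + \<delta> u^(q^3)\<close>, and \<open>N(\<delta>) = \<delta>\<^sup>5 = 1 - \<delta>\<close> is neither 0 nor 1. For \<open>\<epsilon> = 1\<close> take
  \<open>\<delta> = 3 + 1/\<gamma>\<close>; the value \<open>\<delta> = 3\<close>, which is a root exactly in characteristic 7, corresponds
  to \<open>\<gamma> = \<infinity>\<close> and gives \<open>\<epsilon> = 0\<close>.
\<close>

lemma power_q_power_add:
  fixes x y :: "'a :: finite_field"
  assumes "primepow q" and "CARD('a) = q ^ 5"
  shows "(x + y) ^ (q ^ i) = x ^ (q ^ i) + y ^ (q ^ i)"
proof (induction i)
  case (Suc i)
  have "(x + y) ^ (q ^ Suc i) = ((x + y) ^ (q ^ i)) ^ q"
    by (simp add: power_mult[symmetric] mult.commute)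
  also have "\<dots> = (x ^ (q ^ i)) ^ q + (y ^ (q ^ i)) ^ q"
    by (simp add: Suc.IH power_q_add[OF assms])
  finally show ?case by (simp add: power_mult[symmetric] mult.commute)
qed simp

text \<open>Additivity gives this in every characteristic, with no case split on the parity of
  \<open>q\<close>.\<close>

lemma power_q_power_minus:
  fixes x :: "'a :: finite_field"
  assumes "primepow q" and "CARD('a) = q ^ 5"
  shows "(- x) ^ (q ^ i) = - (x ^ (q ^ i))"
proof -
  have "q > 0" using assms(1) primepow_gt_0_nat by blast
  hence "x ^ (q ^ i) + (- x) ^ (q ^ i) = 0"
    using power_q_power_add[OF assms, of x "- x" i] by (simp add: zero_power)
  thus ?thesis by (simp add: add_eq_0_iff)
qed

lemma Fq_power_q_power:
  assumes "x \<in> Fq q"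
  shows "x ^ (q ^ i) = x"
proof (induction i)
  case (Suc i)
  have "x ^ (q ^ Suc i) = (x ^ (q ^ i)) ^ q"
    by (simp add: power_mult[symmetric] mult.commute)
  thus ?case using Suc assms by (simp add: Fq_def)
qed simp

lemma power_q_power_wrap:
  fixes x :: "'a :: finite_field"
  assumes "CARD('a) = q ^ 5"
  shows "x ^ (q ^ (5 + i)) = x ^ (q ^ i)"
  using finite_field_power_card_eq_same[of x] assms by (simp add: power_add power_mult)

text \<open>Raising to the power \<open>q\<close> permutes the five summands cyclically.\<close>

lemma Tr5_in_Fq:
  fixes x :: "'a :: finite_field"
  assumes "primepow q" and "CARD('a) = q ^ 5"
  shows "Tr5 q x \<in> Fq q"
proof -
  have "(x ^ (q ^ i)) ^ q = x ^ (q ^ Suc i)" for i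
    by (simp add: power_mult[symmetric] mult.commute)
  from this[of 0] this[of 1] this[of 2] this[of 3] this[of 4] show ?thesis
    using power_q_power_wrap[OF assms(2), of x 0]
    by (simp add: Fq_def Tr5_def power_q_add[OF assms] eval_nat_numeral)
qed

lemma image_point:
  fixes A :: "('a :: finite_field) ^ 2 ^ 2"
  shows "(*v) A ` point u = point (A *v u)"
  unfolding point_def
  by (simp add: vec.linear_span_image[OF matrix_vector_mul_linear_gen, symmetric])

lemma proj_equiv_linear_set_image:
  fixes A :: "('a :: finite_field) ^ 2 ^ 2"
  assumes "invertible A"
  shows "proj_equiv (linear_set W) (linear_set ((*v) A ` W))"
proof -
  have nz: "A *v w = 0 \<longleftrightarrow> w = 0" for w
    using assms by (metis invertible_def matrix_left_invertible_ker matrix_vector_mult_0_right)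
  have "(\<lambda>P. (*v) A ` P) ` linear_set W = linear_set ((*v) A ` W)"
    by (auto simp: linear_set_def image_iff image_point nz) (use image_point nz in blast)+
  thus ?thesis using assms unfolding proj_equiv_def by blast
qed

lemma linear_set_graph:
  fixes g :: "'a :: finite_field \<Rightarrow> 'a"
  assumes "g 0 = 0"
  shows "linear_set (range (\<lambda>x. vector [x, g x])) = {point (vector [x, g x]) | x. x \<noteq> 0}"
proof -
  have "vector [x, g x] = (0 :: 'a ^ 2) \<longleftrightarrow> x = 0" for x
    using assms by (auto simp: vec_eq_iff forall_2)
  thus ?thesis by (auto simp: linear_set_def)
qed

text \<open>Multiplying the quadratic by \<open>\<delta> + 1\<close> gives
  \<open>\<delta>^3 = -1\<close>, so \<open>\<delta>^5 = - \<delta>^2 = 1 - \<delta>\<close>.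
  Neither 0 nor 1 is a root of the quadratic, hence neither is the norm.\<close>

lemma Nm5_root:
  fixes \<delta> :: "'a :: finite_field"
  assumes "\<delta> \<in> Fq q" and "\<delta>\<^sup>2 - \<delta> + 1 = 0"
  shows "Nm5 q \<delta> \<notin> {0, 1}"
proof -
  have "Nm5 q \<delta> = \<delta> * \<delta> * \<delta> * \<delta> * \<delta>"
    using Fq_power_q_power[OF assms(1), of 1] Fq_power_q_power[OF assms(1)]
    by (simp add: Nm5_def power_add)
  also have "\<dots> = 1 - \<delta>" using assms(2) by algebra
  finally show ?thesis using assms(2) by auto
qed

text \<open>Keeping \<open>t\<close> as a parameter avoids division by \<open>\<delta> - 3\<close>:
  when \<open>\<delta> = 3\<close> the trace vanishes and \<open>t\<close> is free.\<close>

lemma LP_type_family: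
  fixes \<delta> :: "'a :: finite_field"
  assumes q: "primepow q" "CARD('a) = q ^ 5"
    and \<delta>: "\<delta> \<in> Fq q" "\<delta>\<^sup>2 - \<delta> + 1 = 0"
    and W: "W = {vector [x, x ^ q + t] | x t. t \<in> Fq q \<and> Tr5 q x = (\<delta> - 3) * t}"
  shows "LP_type q (linear_set W)"
proof -
  define g where "g u = u ^ (q ^ 2) + \<delta> * u ^ (q ^ 3)" for u :: 'a
  define A :: "'a ^ 2 ^ 2" where "A = vector [vector [- 1, \<delta> - 1], vector [1, 1]]"
  have A: "A *v vector [x, y] = vector [- x + (\<delta> - 1) * y, x + y]" for x y
    by (simp add: A_def vec_eq_iff forall_2 matrix_vector_mult_def sum_2)
  have "det A = - \<delta>" by (simp add: A_def det_2)
  moreover have "\<delta> \<noteq> 0" using \<delta>(2) by auto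
  ultimately have "invertible A" by (simp add: invertible_det_nz)

  have "q > 0" using q(1) primepow_gt_0_nat by blast
  hence "g 0 = 0" by (simp add: g_def zero_power)
  have Fq: "\<delta> - 1 \<in> Fq q" "1 - \<delta> \<in> Fq q"
    using Fq_subfield[OF q] \<delta>(1) by (metis uminus_add_conv_diff diff_conv_add_uminus)+
  note frob = power_q_power_add[OF q] power_q_power_minus[OF q] power_mult_distrib
    Fq_power_q_power[OF \<delta>(1)] Fq_power_q_power[OF Fq(1)]
  have comp: "(x ^ (q ^ i)) ^ (q ^ j) = x ^ (q ^ (i + j))" for x :: 'a and i j
    by (simp add: power_mult[symmetric] power_add)
  have frob1: "x ^ q = x ^ (q ^ 1)" for x :: 'a by simp
  have wrap: "x ^ (q ^ 5) = x" "x ^ (q ^ 6) = x ^ q" "x ^ (q ^ 7) = x ^ (q ^ 2)" for x :: 'a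
    using power_q_power_wrap[OF q(2), of x 0] power_q_power_wrap[OF q(2), of x 1]
      power_q_power_wrap[OF q(2), of x 2] by simp_all

  have "(*v) A ` W = range (\<lambda>u. vector [u, g u])"
  proof (intro subset_antisym subsetI)
    fix w assume "w \<in> (*v) A ` W"
    then obtain x t where t: "t \<in> Fq q" "Tr5 q x = (\<delta> - 3) * t"
      and w: "w = A *v vector [x, x ^ q + t]" unfolding W by blast
    define u where "u = - x + (\<delta> - 1) * (x ^ q + t)"
    have u2: "u ^ (q ^ 2) = - (x ^ (q ^ 2)) + (\<delta> - 1) * (x ^ (q ^ 3) + t)"
      unfolding u_def frob1[of x]
      by (simp only: frob comp Fq_power_q_power[OF t(1)]) (simp add: eval_nat_numeral)
    have u3: "u ^ (q ^ 3) = - (x ^ (q ^ 3)) + (\<delta> - 1) * (x ^ (q ^ 4) + t)"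
      unfolding u_def frob1[of x]
      by (simp only: frob comp Fq_power_q_power[OF t(1)]) (simp add: eval_nat_numeral)
    have "g u = x + (x ^ q + t)"
    proof -
      \<comment> \<open>The conjugates of \<open>x\<close> become independent variables. As
        \<open>\<delta> * (\<delta> - 1) = -1\<close>, the left side collapses to
        \<open>- (x2 + x3 + x4) + (\<delta> - 2) * t\<close>, and the trace relation
        finishes.\<close>
      have "- x2 + (\<delta> - 1) * (x3 + t) + \<delta> * (- x3 + (\<delta> - 1) * (x4 + t)) = x + (x1 + t)"
        if "x + x1 + x2 + x3 + x4 = (\<delta> - 3) * t" for x1 x2 x3 x4
        using that \<delta>(2) by algebra
      from this[OF t(2)[unfolded Tr5_def]] show ?thesis unfolding g_def u2 u3 .
    qed
    thus "w \<in> range (\<lambda>u. vector [u, g u])"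
      using w A u_def by (intro image_eqI[of _ _ u]) simp_all
  next
    fix w :: "'a ^ 2" assume "w \<in> range (\<lambda>u. vector [u, g u])"
    then obtain u where w: "w = vector [u, g u]" by blast
    \<comment> \<open>These solve \<open>A *v vector [x, x ^ q + t] = vector [u, g u]\<close>: the
      first coordinate of the preimage is simplified by \<open>1 / \<delta> = 1 - \<delta>\<close>
      and \<open>(\<delta> - 1)^2 = - \<delta>\<close>, and subtracting \<open>x ^ q\<close> from
      the second leaves a multiple of the trace of \<open>u\<close>.\<close>
    define x where "x = (\<delta> - 1) * (u + u ^ (q ^ 3)) + \<delta> * u ^ (q ^ 2)"
    define t where "t = (1 - \<delta>) * Tr5 q u"
    have x: "x ^ (q ^ i) =
        (\<delta> - 1) * (u ^ (q ^ i) + u ^ (q ^ (3 + i))) + \<delta> * u ^ (q ^ (2 + i))" for i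
      unfolding x_def by (simp only: frob comp)
    have xs: "x ^ q = (\<delta> - 1) * (u ^ q + u ^ (q ^ 4)) + \<delta> * u ^ (q ^ 3)"
      "x ^ (q ^ 2) = (\<delta> - 1) * (u ^ (q ^ 2) + u) + \<delta> * u ^ (q ^ 4)"
      "x ^ (q ^ 3) = (\<delta> - 1) * (u ^ (q ^ 3) + u ^ q) + \<delta> * u"
      "x ^ (q ^ 4) = (\<delta> - 1) * (u ^ (q ^ 4) + u ^ (q ^ 2)) + \<delta> * u ^ q"
      using x[of 1] x[of 2] x[of 3] x[of 4] by (simp_all add: wrap)
    have "t \<in> Fq q"
      unfolding t_def by (intro Fq_subfield(5)[OF q] Fq Tr5_in_Fq[OF q])
    moreover have "Tr5 q x = (\<delta> - 3) * t"
    proof -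
      \<comment> \<open>Each conjugate of \<open>u\<close> occurs with coefficient
        \<open>3 * \<delta> - 2\<close>, which is \<open>(\<delta> - 3) * (1 - \<delta>)\<close> by
        the quadratic.\<close>
      have "(\<delta> - 1) * (u + u3) + \<delta> * u2 + ((\<delta> - 1) * (u1 + u4) + \<delta> * u3)
          + ((\<delta> - 1) * (u2 + u) + \<delta> * u4) + ((\<delta> - 1) * (u3 + u1) + \<delta> * u)
          + ((\<delta> - 1) * (u4 + u2) + \<delta> * u1)
        = (\<delta> - 3) * ((1 - \<delta>) * (u + u1 + u2 + u3 + u4))" for u1 u2 u3 u4
        using \<delta>(2) by algebra
      thus ?thesis unfolding Tr5_def t_def xs unfolding x_def .
    qed
    ultimately have "vector [x, x ^ q + t] \<in> W" unfolding W by blast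
    moreover have "- x + (\<delta> - 1) * (x ^ q + t) = u" "x + (x ^ q + t) = g u"
    proof -
      have "- ((\<delta> - 1) * (u + u3) + \<delta> * u2) + (\<delta> - 1) * ((\<delta> - 1) * (u1 + u4) + \<delta> * u3
          + (1 - \<delta>) * (u + u1 + u2 + u3 + u4)) = u" for u1 u2 u3 u4
        using \<delta>(2) by algebra
      thus "- x + (\<delta> - 1) * (x ^ q + t) = u" unfolding Tr5_def t_def xs unfolding x_def .
      have "(\<delta> - 1) * (u + u3) + \<delta> * u2 + ((\<delta> - 1) * (u1 + u4) + \<delta> * u3
          + (1 - \<delta>) * (u + u1 + u2 + u3 + u4)) = u2 + \<delta> * u3" for u1 u2 u3 u4
        by algebra
      thus "x + (x ^ q + t) = g u" unfolding Tr5_def t_def xs g_def unfolding x_def .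
    qed
    ultimately show "w \<in> (*v) A ` W"
      unfolding w by (metis A image_eqI)
  qed
  hence "proj_equiv (linear_set W) {point (vector [x, g x]) | x. x \<noteq> 0}"
    using proj_equiv_linear_set_image[OF \<open>invertible A\<close>, of W] linear_set_graph[of g, OF \<open>g 0 = 0\<close>]
    by simp
  thus ?thesis
    unfolding LP_type_def g_def using Nm5_root[OF \<delta>]
    by (intro exI[of _ 2] exI[of _ \<delta>]) simp
qed

theorem proposition2p2:
  fixes q :: nat and \<gamma> :: "'a :: finite_field"
  assumes "primepow q" and "CARD('a) = q ^ 5"
    and "\<gamma> \<in> Fq q" and "\<gamma> \<noteq> 0"
  shows "(CHAR('a) = 7 \<longrightarrow> LP_type q (linear_set (W0 q \<gamma>))) \<and>
         (7 * \<gamma>\<^sup>2 + 5 * \<gamma> + 1 = 0 \<longrightarrow> LP_type q (linear_set (W1 q \<gamma>)))"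
proof (intro conjI impI)
  note q = assms(1,2)
  note subfield = Fq_subfield[OF q]
  have three: "(3 :: 'a) \<in> Fq q"
    using subfield(3)[OF subfield(3)[OF subfield(2) subfield(2)] subfield(2)] by simp
  show "LP_type q (linear_set (W0 q \<gamma>))" if "CHAR('a) = 7"
  proof (rule LP_type_family[OF q three])
    have "of_nat 7 = (0 :: 'a)" using that of_nat_CHAR[where ?'a = 'a] by metis
    thus "3\<^sup>2 - 3 + (1 :: 'a) = 0" by simp
    \<comment> \<open>Multiplication by \<open>\<gamma>\<close> permutes \<open>Fq q\<close>, so
      \<open>\<gamma> * h\<close> serves as the free parameter \<open>t\<close>.\<close>
    have "\<gamma> * h \<in> Fq q" if "h \<in> Fq q" for h
      using subfield(5) assms(3) that by blast
    moreover have "\<exists>h \<in> Fq q. t = \<gamma> * h" if "t \<in> Fq q" for t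
      using subfield(5)[OF subfield(6)[OF assms(3)] that] assms(4)
      by (intro bexI[of _ "inverse \<gamma> * t"]) simp_all
    ultimately show
      "W0 q \<gamma> = {vector [x, x ^ q + t] | x t. t \<in> Fq q \<and> Tr5 q x = (3 - 3) * t}"
      unfolding W0_def by auto blast
  qed
  show "LP_type q (linear_set (W1 q \<gamma>))" if root: "7 * \<gamma>\<^sup>2 + 5 * \<gamma> + 1 = 0"
  proof (rule LP_type_family[OF q, of "3 + inverse \<gamma>"])
    show "3 + inverse \<gamma> \<in> Fq q"
      using subfield(3)[OF three subfield(6)[OF assms(3)]] .
    have inv: "\<gamma> * inverse \<gamma> = 1" using assms(4) by simp
    \<comment> \<open>The left side expands to \<open>7 + 5 / \<gamma> + 1 / \<gamma>^2\<close>, the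
      assumed equation divided by \<open>\<gamma>^2\<close>.\<close>
    show "(3 + inverse \<gamma>)\<^sup>2 - (3 + inverse \<gamma>) + 1 = 0"
      using inv root by algebra
    \<comment> \<open>The factor \<open>\<delta> - 3\<close> is now the unit
      \<open>inverse \<gamma>\<close>, so the trace determines \<open>t\<close>.\<close>
    have "t \<in> Fq q \<and> Tr5 q x = (3 + inverse \<gamma> - 3) * t \<longleftrightarrow> t = \<gamma> * Tr5 q x" for x t
      using subfield(5)[OF assms(3) Tr5_in_Fq[OF q]] assms(4) by (auto simp: field_simps)
    thus "W1 q \<gamma> = {vector [x, x ^ q + t] | x t. t \<in> Fq q \<and> Tr5 q x = (3 + inverse \<gamma> - 3) * t}"
      unfolding W1_def by auto
  qed
qed

end
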